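(* Let $p$ be a prime, $\lambda$ a partition, and let $J\subset I\subset P_\lambda$ be ideals of $P_\lambda$. Then there is a canonical bijective correspondence between the ideals in $P_\lambda$ which are contained in $I$ and contain $J$ (equivalently, ideals in the induced subposet $I-J$) and the $G_{p,\lambda}$-orbits in $A_{p,I}/A_{p,J}$.
   Context: A partition is a non-increasing sequence $\lambda=(\lambda_1\geq\cdots\geq\lambda_l)$ of positive integers. $A_{p,\lambda}=\mathbf{Z}/p^{\lambda_1}\mathbf{Z}\oplus\cdots\oplus\mathbf{Z}/p^{\lambda_l}\mathbf{Z}$ and $G_{p,\lambda}$ is its automorphism group. Fundamental poset $P$: its elements are the symbols $(p^r,k)$ with integers $0\leq r<k$, where $(p^r,k)$ stands for the orbit of $p^r$ in $\mathbf{Z}/p^k\mathbf{Z}$ under automorphisms of $\mathbf{Z}/p^k\mathbf{Z}$, i.e. the set of elements $p^ru$ with $p\nmid u$. The partial order is: $(p^r,k)\geq(p^s,l)$ if and only if $r\leq s$ and $k-r\geq l-s$ (equivalently, some homomorphism $\mathbf{Z}/p^k\mathbf{Z}\to\mathbf{Z}/p^l\mathbf{Z}$ maps $p^r$ to $p^s$). $P_\lambda$ is the induced subposet consisting of the elements $(p^r,k)$ with $k=\lambda_i$ for some $i$. An ideal of a poset is a (possibly empty) down-closed subset; $I-J$ denotes set difference. For $a=(a_1,\ldots,a_l)\in A_{p,\lambda}$, $I(a)$ is the ideal of $P$ generated by the orbits of the non-zero coordinates $a_i\in\mathbf{Z}/p^{\lambda_i}\mathbf{Z}$ ($a_i=p^ru\neq0$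 with $p\nmid u$ contributes $(p^r,\lambda_i)$), and $I_\lambda(a)=I(a)\cap P_\lambda$. For an ideal $I$ of $P_\lambda$, $A_{p,I}=\{a\in A_{p,\lambda}: I_\lambda(a)\subset I\}$, a subgroup of $A_{p,\lambda}$ invariant under $G_{p,\lambda}$. For ideals $J\subset I$ one has $A_{p,J}\subset A_{p,I}$, and the action of $G_{p,\lambda}$ on $A_{p,\lambda}$ descends to an action on the subquotient $A_{p,I}/A_{p,J}$. *)

theory Defs
  imports
    "HOL.Hull"
    "HOL-Algebra.Elementary_Groups"
    "HOL-Algebra.Product_Groups"
    "HOL-Algebra.Group_Action"
    "HOL-Computational_Algebra.Primes"
begin

definition is_partition :: "nat list \<Rightarrow> bool" where
  "is_partition lam \<longleftrightarrow> sorted_wrt (\<ge>) lam \<and> (\<forall>k\<in>set lam. 0 < k)"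

definition Apgrp :: "nat \<Rightarrow> nat list \<Rightarrow> (nat \<Rightarrow> int) monoid" where
  "Apgrp p lam = product_group {..<length lam} (\<lambda>i. integer_mod_group (p ^ (lam ! i)))"

text \<open>The symbol written (p^r, k), that is, the orbit of p^r in Z/p^k, is encoded as the
  pair (r, k); the poset itself does not depend on p. Below fle x y means that x is
  less than or equal to y; it is only used for elements of fundP, where the
  subtractions do not truncate.\<close>

definition fundP :: "(nat \<times> nat) set" where
  "fundP = {(r, k). r < k}"

definition fle :: "nat \<times> nat \<Rightarrow> nat \<times> nat \<Rightarrow> bool" where
  "fle = (\<lambda>(s, l) (r, k). r \<le> s \<and> l - s \<le> k - r)"

definition fundP_of :: "nat list \<Rightarrow> (nat \<times> nat) set" where
  "fundP_of lam = {(r, k) \<in> fundP. k \<in> set lam}"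

definition is_ideal :: "(nat \<times> nat) set \<Rightarrow> (nat \<times> nat) set \<Rightarrow> bool" where
  "is_ideal Q I \<longleftrightarrow> I \<subseteq> Q \<and> (\<forall>x\<in>I. \<forall>y\<in>Q. fle y x \<longrightarrow> y \<in> I)"

text \<open>Coordinates are the representatives in {0..<p^k}; a nonzero one equals p^r u with p
  not dividing u for r its p-adic multiplicity.\<close>

definition coord_orbits :: "nat \<Rightarrow> nat list \<Rightarrow> (nat \<Rightarrow> int) \<Rightarrow> (nat \<times> nat) set" where
  "coord_orbits p lam a =
     {(multiplicity (int p) (a i), lam ! i) | i. i < length lam \<and> a i \<noteq> 0}"

definition ideal_of :: "nat \<Rightarrow> nat list \<Rightarrow> (nat \<Rightarrow> int) \<Rightarrow> (nat \<times> nat) set" where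
  "ideal_of p lam a = (is_ideal fundP) hull (coord_orbits p lam a)"

definition lam_ideal_of :: "nat \<Rightarrow> nat list \<Rightarrow> (nat \<Rightarrow> int) \<Rightarrow> (nat \<times> nat) set" where
  "lam_ideal_of p lam a = ideal_of p lam a \<inter> fundP_of lam"

definition A_ideal :: "nat \<Rightarrow> nat list \<Rightarrow> (nat \<times> nat) set \<Rightarrow> (nat \<Rightarrow> int) set" where
  "A_ideal p lam I = {a \<in> carrier (Apgrp p lam). lam_ideal_of p lam a \<subseteq> I}"

definition subquotient ::
    "nat \<Rightarrow> nat list \<Rightarrow> (nat \<times> nat) set \<Rightarrow> (nat \<times> nat) set \<Rightarrow> (nat \<Rightarrow> int) set monoid" where
  "subquotient p lam I J = ((Apgrp p lam)\<lparr>carrier := A_ideal p lam I\<rparr>) Mod (A_ideal p lam J)"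

definition subquotient_action ::
    "nat \<Rightarrow> nat list \<Rightarrow> (nat \<times> nat) set \<Rightarrow> (nat \<times> nat) set \<Rightarrow>
     ((nat \<Rightarrow> int) \<Rightarrow> (nat \<Rightarrow> int)) \<Rightarrow> (nat \<Rightarrow> int) set \<Rightarrow> (nat \<Rightarrow> int) set" where
  "subquotient_action p lam I J g = (\<lambda>X\<in>carrier (subquotient p lam I J). g ` X)"

definition ideals_between ::
    "nat list \<Rightarrow> (nat \<times> nat) set \<Rightarrow> (nat \<times> nat) set \<Rightarrow> (nat \<times> nat) set set" where
  "ideals_between lam J I = {K. is_ideal (fundP_of lam) K \<and> J \<subseteq> K \<and> K \<subseteq> I}"

end

theory Submission
  imports Defs
begin

text \<open>For an ideal K, the group A_{p,K} is cut out by the conditions that p^(t_i) divides the i-th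
  coordinate, where t_i is the least r with (r, lam_i) in K. Comparing t_i and t_j shows that every
  endomorphism preserves A_{p,K}; hence the ideal generated by I(a) and J depends only on the orbit
  of the class of a. Conversely, put K = I(a) \<union> J. One coordinate at a time, a can be moved to the
  canonical element of K, with coordinates p^(t_i): either (t_i, lam_i) lies in J and the change is
  invisible modulo A_{p,J}, or (t_i, lam_i) lies below the orbit of some coordinate a_j and an
  elementary automorphism effects the change. Since K does not change in the process, all elements
  with the same K are in the orbit of the same canonical element.\<close>

section \<open>Ideals between \<open>J\<close> and \<open>I\<close> versus ideals of the
  difference\<close>

text \<open>The inverse adds \<open>J\<close> back: an element of \<open>fundP_of lam\<close> below
  one of \<open>L\<close> lies in \<open>I\<close>, hence in \<open>J\<close> or in
  \<open>I - J\<close>, where \<open>L\<close> is down-closed.\<close>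

lemma ideals_between_bij_ideals_diff:
  assumes I: "is_ideal (fundP_of lam) I" and J: "is_ideal (fundP_of lam) J" and JI: "J \<subseteq> I"
  shows "bij_betw (\<lambda>K. K - J) (ideals_between lam J I) {L. is_ideal (I - J) L}"
proof (rule bij_betw_byWitness[where f' = "\<lambda>L. L \<union> J"])
  show "\<forall>K\<in>ideals_between lam J I. (K - J) \<union> J = K"
    by (auto simp: ideals_between_def)
  show "\<forall>L\<in>{L. is_ideal (I - J) L}. (L \<union> J) - J = L"
    by (auto simp: is_ideal_def)
  show "(\<lambda>K. K - J) ` ideals_between lam J I \<subseteq> {L. is_ideal (I - J) L}"
    using I unfolding ideals_between_def is_ideal_def by blast
  show "(\<lambda>L. L \<union> J) ` {L. is_ideal (I - J) L} \<subseteq> ideals_between lam J I"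
    using I J JI unfolding ideals_between_def is_ideal_def by blast
qed

section \<open>The order and the exponents that describe an ideal\<close>

lemma fle_refl: "fle x x"
  by (simp add: fle_def split: prod.splits)

lemma fle_trans: "fle x y \<Longrightarrow> fle y z \<Longrightarrow> fle x z"
  by (auto simp: fle_def split: prod.splits)

lemma is_ideal_Un: "is_ideal Q K \<Longrightarrow> is_ideal Q L \<Longrightarrow> is_ideal Q (K \<union> L)"
  unfolding is_ideal_def by blast

text \<open>When no (r, lam ! i) lies in K, the value is lam ! i, so that p^(ideal_exp lam K i)
  vanishes in Z/p^(lam ! i).\<close>

definition ideal_exp :: "nat list \<Rightarrow> (nat \<times> nat) set \<Rightarrow> nat \<Rightarrow> nat" where
  "ideal_exp lam K i = (LEAST r. r < lam ! i \<longrightarrow> (r, lam ! i) \<in> K)"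

lemma ideal_exp_le: "ideal_exp lam K i \<le> lam ! i"
  unfolding ideal_exp_def by (rule Least_le) simp

lemma ideal_exp_antimono:
  assumes "J \<subseteq> K" shows "ideal_exp lam K i \<le> ideal_exp lam J i"
proof -
  have "ideal_exp lam J i < lam ! i \<longrightarrow> (ideal_exp lam J i, lam ! i) \<in> J"
    unfolding ideal_exp_def by (rule LeastI[of _ "lam ! i"]) simp
  with assms show ?thesis
    unfolding ideal_exp_def[of lam K] by (intro Least_le) blast
qed

text \<open>Elements with the same second entry form a chain that descends as \<open>r\<close>
  grows, so an ideal meets it in a final segment of exponents.\<close>

lemma mem_ideal_iff:
  assumes K: "is_ideal (fundP_of lam) K" and i: "i < length lam" and r: "r < lam ! i"
  shows "(r, lam ! i) \<in> K \<longleftrightarrow> ideal_exp lam K i \<le> r"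
proof
  assume "(r, lam ! i) \<in> K"
  then show "ideal_exp lam K i \<le> r" 
    unfolding ideal_exp_def by (intro Least_le) simp
next
  let ?t = "ideal_exp lam K i"
  assume le: "?t \<le> r"
  have "?t < lam ! i \<longrightarrow> (?t, lam ! i) \<in> K"
    unfolding ideal_exp_def by (rule LeastI[of _ "lam ! i"]) simp
  then have "(?t, lam ! i) \<in> K" using le r by simp
  moreover have "(r, lam ! i) \<in> fundP_of lam"
    using r i by (simp add: fundP_of_def fundP_def)
  moreover have "fle (r, lam ! i) (?t, lam ! i)"
    using le by (simp add: fle_def)
  ultimately show "(r, lam ! i) \<in> K" using K unfolding is_ideal_def by blast
qed

text \<open>Down-closure across two columns, put into the form in which it bounds the image of a
  homomorphism from the \<open>i\<close>-th to the \<open>j\<close>-th cyclic summand.\<close>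

lemma ideal_exp_compare:
  assumes K: "is_ideal (fundP_of lam) K" and i: "i < length lam" and j: "j < length lam"
  shows "ideal_exp lam K j \<le> ideal_exp lam K i \<or>
    ideal_exp lam K j + lam ! i \<le> lam ! j + ideal_exp lam K i"
proof (rule ccontr)
  let ?t = "ideal_exp lam K"
  assume neg: "\<not> ?thesis"
  \<comment> \<open>The least exponent for which \<open>(s, lam ! j)\<close> lies below
    \<open>(?t i, lam ! i)\<close>; failure of both alternatives puts it under
    \<open>?t j\<close>.\<close>
  define s where "s = max (?t i) (lam ! j + ?t i - lam ! i)"
  have s: "s < ?t j" using neg ideal_exp_le[of lam K i] by (auto simp: s_def)
  then have sj: "s < lam ! j" using ideal_exp_le[of lam K j] by simp
  \<comment> \<open>Since \<open>?t j \<le> lam ! j\<close>, the default value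
    \<open>lam ! i\<close> is ruled out and \<open>?t i\<close> belongs to an actual element of
    \<open>K\<close>.\<close>
  have ti: "?t i < lam ! i" using neg ideal_exp_le[of lam K i] ideal_exp_le[of lam K j] by auto
  then have "(?t i, lam ! i) \<in> K" using mem_ideal_iff[OF K i] by simp
  moreover have "(s, lam ! j) \<in> fundP_of lam"
    using sj j by (simp add: fundP_of_def fundP_def)
  moreover have "fle (s, lam ! j) (?t i, lam ! i)"
    using ti sj by (auto simp: fle_def s_def)
  ultimately have "(s, lam ! j) \<in> K" using K unfolding is_ideal_def by blast
  then show False using mem_ideal_iff[OF K j sj] s by simp
qed

lemma multiplicity_less_of_less_power:
  fixes q x :: int
  assumes "1 < q" and "0 < x" and "x < q ^ k"
  shows "multiplicity q x < k"
proof -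
  have "q ^ multiplicity q x \<le> x"
    using assms multiplicity_dvd zdvd_imp_le by blast
  then show ?thesis using assms by (meson le_less_trans power_less_imp_less_exp)
qed

lemma fundP_of_E:
  assumes "x \<in> fundP_of lam"
  obtains r i where "x = (r, lam ! i)" "i < length lam" "r < lam ! i"
  using assms by (auto simp: fundP_of_def fundP_def in_set_conv_nth)

section \<open>The group \<open>A\<close> in coordinates\<close>

locale abelian_p_group =
  fixes p :: nat and lam :: "nat list"
  assumes prime: "prime p"
begin

abbreviation "A \<equiv> Apgrp p lam"
abbreviation "q \<equiv> int p"
abbreviation "ideal \<equiv> is_ideal (fundP_of lam)"
abbreviation "ex \<equiv> ideal_exp lam"

lemma prime_q: "prime q" using prime by simp

lemma q_gt_1: "1 < q" using prime_gt_1_int[OF prime_q] .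

lemma p_pos [simp]: "0 < p" using prime by (rule prime_gt_0_nat)

lemma p_nonzero [simp]: "p \<noteq> 0" using p_pos by simp

lemma group_A: "group A"
  by (simp add: Apgrp_def)

sublocale group A by (rule group_A)

lemma carrier_A: "a \<in> carrier A \<longleftrightarrow>
    a \<in> extensional {..<length lam} \<and> (\<forall>i<length lam. 0 \<le> a i \<and> a i < q ^ (lam ! i))"
  by (auto simp: Apgrp_def PiE_iff carrier_integer_mod_group)

lemma mult_A: "a \<otimes>\<^bsub>A\<^esub> b = (\<lambda>i\<in>{..<length lam}. (a i + b i) mod q ^ (lam ! i))"
  by (simp add: Apgrp_def)

lemma one_A: "\<one>\<^bsub>A\<^esub> = (\<lambda>i\<in>{..<length lam}. 0)"
  by (simp add: Apgrp_def)

lemma inv_A: 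
  assumes "a \<in> carrier A"
  shows "inv\<^bsub>A\<^esub> a = (\<lambda>i\<in>{..<length lam}. (- a i) mod q ^ (lam ! i))"
  using assms inv_product_group[of a "{..<length lam}" "\<lambda>i. integer_mod_group (p ^ (lam ! i))"]
  by (auto simp: Apgrp_def PiE_iff intro!: restrict_ext)

lemma carrier_A_eqI:
  assumes "a \<in> carrier A" "b \<in> carrier A" "\<And>i. i < length lam \<Longrightarrow> a i = b i"
  shows "a = b"
  using assms by (intro extensionalityI[of _ "{..<length lam}"]) (auto simp: carrier_A)

lemma carrier_A_mod: 
  assumes "a \<in> carrier A" "i < length lam" shows "a i mod q ^ (lam ! i) = a i"
  using assms by (simp add: carrier_A)

lemma pow_A:
  assumes "a \<in> carrier A" "i < length lam"
  shows "(a [^]\<^bsub>A\<^esub> (n::nat)) i = (int n * a i) mod q ^ (lam ! i)"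
proof (induction n)
  case 0
  then show ?case using assms by (simp add: one_A)
next
  case (Suc n)
  then show ?case using assms by (simp add: mult_A mod_simps algebra_simps)
qed

section \<open>The subgroups \<open>A_ideal\<close> as divisibility conditions\<close>

lemma coord_orbits_subset:
  assumes "a \<in> carrier A" shows "coord_orbits p lam a \<subseteq> fundP_of lam"
proof -
  have "multiplicity q (a i) < lam ! i" if "i < length lam" "a i \<noteq> 0" for i
    using multiplicity_less_of_less_power[OF q_gt_1, of "a i"] assms that
    by (force simp: carrier_A)
  then show ?thesis by (auto simp: coord_orbits_def fundP_of_def fundP_def)
qed

text \<open>The down-closure of the coordinate orbits is an ideal by transitivity and lies in every
  ideal containing them, so it is the hull.\<close>

lemma lam_ideal_of_eq:
  assumes "a \<in> carrier A"
  shows "lam_ideal_of p lam a = {x \<in> fundP_of lam. \<exists>y\<in>coord_orbits p lam a. fle x y}"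
proof -
  have sub: "coord_orbits p lam a \<subseteq> fundP" 
    using coord_orbits_subset[OF assms] by (auto simp: fundP_of_def)
  have "is_ideal fundP hull coord_orbits p lam a = {x \<in> fundP. \<exists>y\<in>coord_orbits p lam a. fle x y}"
  proof (rule hull_unique)
    show "coord_orbits p lam a \<subseteq> {x \<in> fundP. \<exists>y\<in>coord_orbits p lam a. fle x y}"
      using sub fle_refl by blast
    show "is_ideal fundP {x \<in> fundP. \<exists>y\<in>coord_orbits p lam a. fle x y}"
      unfolding is_ideal_def by (auto intro: fle_trans)
  qed (auto simp: is_ideal_def)
  then show ?thesis
    by (auto simp: lam_ideal_of_def ideal_of_def fundP_of_def)
qed

lemma ideal_lam_ideal_of:
  assumes "a \<in> carrier A" shows "ideal (lam_ideal_of p lam a)"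
  unfolding lam_ideal_of_eq[OF assms] is_ideal_def by (auto intro: fle_trans)

text \<open>As \<open>K\<close> is down-closed, only the generators of the ideal need to lie in
  \<open>K\<close>. A zero coordinate gives no generator and satisfies its divisibility condition
  trivially.\<close>

lemma mem_A_ideal:
  assumes "ideal K"
  shows "a \<in> A_ideal p lam K \<longleftrightarrow> a \<in> carrier A \<and> (\<forall>i<length lam. q ^ ex K i dvd a i)"
proof (cases "a \<in> carrier A")
  case True
  have "lam_ideal_of p lam a \<subseteq> K \<longleftrightarrow> coord_orbits p lam a \<subseteq> K"
    using coord_orbits_subset[OF True] assms fle_refl
    unfolding lam_ideal_of_eq[OF True] is_ideal_def by blast
  also have "\<dots> \<longleftrightarrow> (\<forall>i<length lam. a i \<noteq> 0 \<longrightarrow> (multiplicity q (a i), lam ! i) \<in> K)"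
    by (auto simp: coord_orbits_def)
  also have "\<dots> \<longleftrightarrow> (\<forall>i<length lam. q ^ ex K i dvd a i)"
  proof -
    have "(multiplicity q (a i), lam ! i) \<in> K \<longleftrightarrow> q ^ ex K i dvd a i"
      if i: "i < length lam" and "a i \<noteq> 0" for i
    proof -
      have "multiplicity q (a i) < lam ! i"
        using coord_orbits_subset[OF True] that by (auto simp: coord_orbits_def fundP_of_def fundP_def)
      then have "(multiplicity q (a i), lam ! i) \<in> K \<longleftrightarrow> ex K i \<le> multiplicity q (a i)"
        using mem_ideal_iff[OF assms i] by simp
      also have "\<dots> \<longleftrightarrow> q ^ ex K i dvd a i"
        using \<open>a i \<noteq> 0\<close> q_gt_1 by (subst power_dvd_iff_le_multiplicity) auto
      finally show ?thesis .
    qed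
    then show ?thesis by (metis dvd_0_right)
  qed
  finally show ?thesis using True by (simp add: A_ideal_def)
qed (simp add: A_ideal_def)

lemma A_ideal_carrier: "a \<in> A_ideal p lam K \<Longrightarrow> a \<in> carrier A"
  by (simp add: A_ideal_def)

lemma A_ideal_iff: "a \<in> carrier A \<Longrightarrow> a \<in> A_ideal p lam K \<longleftrightarrow> lam_ideal_of p lam a \<subseteq> K"
  by (simp add: A_ideal_def)

lemma A_ideal_mono: "J \<subseteq> K \<Longrightarrow> A_ideal p lam J \<subseteq> A_ideal p lam K"
  by (auto simp: A_ideal_def)

lemma subgroup_A_ideal:
  assumes "ideal K" shows "subgroup (A_ideal p lam K) A"
proof (rule subgroupI)
  show "A_ideal p lam K \<subseteq> carrier A" by (auto simp: A_ideal_def)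
  have "\<one>\<^bsub>A\<^esub> \<in> A_ideal p lam K"
    by (auto simp: mem_A_ideal[OF assms] one_A carrier_A)
  then show "A_ideal p lam K \<noteq> {}" by blast
next
  \<comment> \<open>Hence the divisibility conditions survive reduction modulo
    \<open>q ^ (lam ! i)\<close>.\<close>
  have dvd: "q ^ ex K i dvd q ^ (lam ! i)" for i
    by (simp add: ideal_exp_le le_imp_power_dvd)
  fix a b assume a: "a \<in> A_ideal p lam K"
  then show "inv\<^bsub>A\<^esub> a \<in> A_ideal p lam K"
    using dvd inv_closed[of a] by (auto simp: mem_A_ideal[OF assms] inv_A intro!: dvd_mod)
  assume b: "b \<in> A_ideal p lam K"
  show "a \<otimes>\<^bsub>A\<^esub> b \<in> A_ideal p lam K"
    using a b dvd m_closed[of a b] by (auto simp: mem_A_ideal[OF assms] mult_A intro!: dvd_mod)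
qed

section \<open>Endomorphisms preserve \<open>A_ideal\<close>\<close>

definition single :: "nat \<Rightarrow> int \<Rightarrow> nat \<Rightarrow> int" where
  "single n x = (\<lambda>i\<in>{..<length lam}. if i = n then x mod q ^ (lam ! i) else 0)"

lemma single_carrier [simp]: "single n x \<in> carrier A"
  by (auto simp: carrier_A single_def)

lemma single_apply: "i < length lam \<Longrightarrow> single n x i = (if i = n then x mod q ^ (lam ! i) else 0)"
  by (simp add: single_def)

lemma single_pow: "single n x [^]\<^bsub>A\<^esub> (k::nat) = single n (int k * x)"
  by (rule carrier_A_eqI) (auto simp: pow_A single_apply mod_simps)

text \<open>With \<open>x = q ^ ex K n * z\<close>, the image is the \<open>q ^ ex K n\<close>-fold
  multiple of \<open>h = g (single n z)\<close>. Moreover \<open>h\<close> is annihilated by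
  \<open>q ^ (lam ! n)\<close>, and comparing exponents turns this into the required
  divisibility.\<close>

lemma hom_single:
  assumes K: "ideal K" and g: "g \<in> hom A A" and n: "n < length lam" and x: "q ^ ex K n dvd x"
  shows "g (single n x) \<in> A_ideal p lam K"
proof -
  interpret g: group_hom A A g
    using g by unfold_locales
  obtain z where z: "x = q ^ ex K n * z" using x by (rule dvdE)
  define h where "h = g (single n z)"
  have h: "h \<in> carrier A" by (simp add: h_def)
  have hk: "g (single n (q ^ k * z)) = h [^]\<^bsub>A\<^esub> (p ^ k)" for k
    using single_pow[of n z "p ^ k"] g.hom_nat_pow[of "single n z" "p ^ k"] by (simp add: h_def)
  have "single n (q ^ (lam ! n) * z) = \<one>\<^bsub>A\<^esub>"
    by (rule carrier_A_eqI[OF single_carrier one_closed]) (auto simp: single_apply one_A)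
  then have "h [^]\<^bsub>A\<^esub> (p ^ (lam ! n)) = \<one>\<^bsub>A\<^esub>"
    using hk[of "lam ! n"] g.hom_one by simp
  then have ann: "q ^ (lam ! j) dvd q ^ (lam ! n) * h j" if "j < length lam" for j
    using pow_A[OF h that, of "p ^ (lam ! n)"] that by (simp add: one_A mod_eq_0_iff_dvd)
  have "q ^ ex K j dvd q ^ ex K n * h j" if j: "j < length lam" for j
    using ideal_exp_compare[OF K n j]
  proof
    assume "ex K j \<le> ex K n"
    then show ?thesis by (simp add: dvd_mult2 le_imp_power_dvd)
  next
    \<comment> \<open>Here the factor is supplied by the annihilation of \<open>h\<close>: multiply
      the claim by \<open>q ^ (lam ! n)\<close>, apply \<open>ann\<close>, and cancel.\<close>
    assume "ex K j + lam ! n \<le> lam ! j + ex K n"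
    then have "q ^ (ex K j + lam ! n) dvd q ^ (lam ! j + ex K n)" by (rule le_imp_power_dvd)
    also have "\<dots> dvd q ^ (lam ! n) * h j * q ^ ex K n"
      using ann[OF j] by (simp add: power_add)
    finally have "q ^ (lam ! n) * q ^ ex K j dvd q ^ (lam ! n) * (q ^ ex K n * h j)"
      by (simp add: power_add mult_ac)
    then show ?thesis by (subst (asm) dvd_mult_cancel_left) simp
  qed
  then have "q ^ ex K j dvd (h [^]\<^bsub>A\<^esub> (p ^ ex K n)) j" if "j < length lam" for j
    using that by (simp add: pow_A[OF h] dvd_mod ideal_exp_le le_imp_power_dvd)
  then show ?thesis
    using h by (simp add: mem_A_ideal[OF K] z hk)
qed

text \<open>By additivity it is enough to treat one coordinate at a time; the truncations
  \<open>tr n\<close> assemble \<open>a\<close> from its single-coordinate parts.\<close>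

lemma hom_A_ideal:
  assumes K: "ideal K" and g: "g \<in> hom A A" and a: "a \<in> A_ideal p lam K"
  shows "g a \<in> A_ideal p lam K"
proof -
  interpret g: group_hom A A g
    using g by unfold_locales
  interpret K: subgroup "A_ideal p lam K" A by (rule subgroup_A_ideal[OF K])
  define tr where "tr n = (\<lambda>i\<in>{..<length lam}. if i < n then a i else 0)" for n
  have ac: "a \<in> carrier A" using a by (rule A_ideal_carrier)
  have tr: "tr n \<in> carrier A" for n using ac by (auto simp: tr_def carrier_A)
  have "g (tr n) \<in> A_ideal p lam K" if "n \<le> length lam" for n
    using that
  proof (induction n)
    case 0
    have "tr 0 = \<one>\<^bsub>A\<^esub>" by (simp add: tr_def one_A)
    then show ?case using g.hom_one by simp
  next
    case (Suc n)
    have "tr (Suc n) = tr n \<otimes>\<^bsub>A\<^esub> single n (a n)"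
      by (rule carrier_A_eqI[OF tr m_closed[OF tr single_carrier]])
         (use ac tr in \<open>auto simp: mult_A tr_def single_apply carrier_A_mod less_Suc_eq\<close>)
    then have "g (tr (Suc n)) = g (tr n) \<otimes>\<^bsub>A\<^esub> g (single n (a n))"
      using g.hom_mult[OF tr single_carrier] by simp
    moreover have "g (single n (a n)) \<in> A_ideal p lam K"
      using Suc.prems a by (intro hom_single[OF K g]) (auto simp: mem_A_ideal[OF K])
    ultimately show ?case using Suc by simp
  qed
  moreover have "tr (length lam) = a"
    by (rule carrier_A_eqI[OF tr ac]) (simp add: tr_def)
  ultimately show ?thesis by (metis order_refl)
qed

section \<open>Elementary automorphisms\<close>

text \<open>One family covers both moves used later: \<open>m = 0\<close> rescales a coordinate by a
  unit, \<open>u = 1\<close> adds a multiple of another coordinate. The restriction to the carrier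
  is there because \<open>auto\<close> consists of extensional maps.\<close>

definition elementary :: "int \<Rightarrow> int \<Rightarrow> nat \<Rightarrow> nat \<Rightarrow> (nat \<Rightarrow> int) \<Rightarrow> nat \<Rightarrow> int" where
  "elementary u m i j = (\<lambda>a\<in>carrier A. a(j := (u * a j + m * a i) mod q ^ (lam ! j)))"

lemma elementary_carrier:
  assumes "j < length lam" "a \<in> carrier A"
  shows "elementary u m i j a \<in> carrier A"
  using assms by (auto simp: elementary_def carrier_A extensional_def)

text \<open>The composition changes only coordinate \<open>j\<close>, to
  \<open>u * u' * a j + (u * m' + m) * a i\<close>, which the congruences reduce to
  \<open>a j\<close>. For \<open>i = j\<close> the outer map would read the changed coordinate,
  hence the zero multipliers.\<close>

lemma elementary_inverse:
  assumes j: "j < length lam" and a: "a \<in> carrier A"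
    and i: "i = j \<Longrightarrow> m = 0 \<and> m' = 0"
    and u: "q ^ (lam ! j) dvd u * u' - 1" and m: "q ^ (lam ! j) dvd u * m' + m"
  shows "elementary u m i j (elementary u' m' i j a) = a"
proof (rule carrier_A_eqI)
  let ?Q = "q ^ (lam ! j)"
  fix k assume "k < length lam"
  have "(u * ((u' * a j + m' * a i) mod ?Q) + m * a i) mod ?Q = (u * (u' * a j + m' * a i) + m * a i) mod ?Q"
    by (metis mod_add_left_eq mod_mult_right_eq)
  also have "\<dots> = a j mod ?Q"
  proof -
    have "u * (u' * a j + m' * a i) + m * a i - a j = (u * u' - 1) * a j + (u * m' + m) * a i"
      by (simp add: algebra_simps)
    then show ?thesis using u m by (simp add: mod_eq_dvd_iff)
  qed
  finally have "(u * ((u' * a j + m' * a i) mod ?Q) + m * a i) mod ?Q = a j"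
    using carrier_A_mod[OF a j] by simp
  then show "elementary u m i j (elementary u' m' i j a) k = a k"
    using i elementary_carrier[OF j a, of u' m' i] a by (auto simp: elementary_def)
qed (use a j in \<open>auto intro!: elementary_carrier\<close>)

lemma elementary_hom:
  assumes j: "j < length lam" and i: "i < length lam"
    and m: "q ^ (lam ! j) dvd m * q ^ (lam ! i)"
  shows "elementary u m i j \<in> hom A A"
proof (rule homI)
  let ?Q = "q ^ (lam ! j)"
  fix a b assume a: "a \<in> carrier A" and b: "b \<in> carrier A"
  \<comment> \<open>Multiplication by \<open>m\<close> is well defined from residues modulo
    \<open>q ^ (lam ! i)\<close> to residues modulo \<open>?Q\<close>.\<close>
  have *: "(m * (x mod q ^ (lam ! i))) mod ?Q = (m * x) mod ?Q" for x
  proof -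
    have "m * (x mod q ^ (lam ! i)) - m * x = - (m * q ^ (lam ! i)) * (x div q ^ (lam ! i))"
      by (simp add: minus_mult_div_eq_mod [symmetric] algebra_simps)
    then show ?thesis using m by (simp add: mod_eq_dvd_iff)
  qed
  have "(u * ((a j + b j) mod ?Q) + m * ((a i + b i) mod q ^ (lam ! i))) mod ?Q
      = (u * (a j + b j) + m * (a i + b i)) mod ?Q"
    by (rule mod_add_cong) (simp_all add: * mod_mult_right_eq)
  also have "\<dots> = ((u * a j + m * a i) mod ?Q + (u * b j + m * b i) mod ?Q) mod ?Q"
    unfolding mod_add_eq by (simp add: algebra_simps)
  finally have eq: "(u * ((a j + b j) mod ?Q) + m * ((a i + b i) mod q ^ (lam ! i))) mod ?Q
      = ((u * a j + m * a i) mod ?Q + (u * b j + m * b i) mod ?Q) mod ?Q" .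
  have ab: "a \<otimes>\<^bsub>A\<^esub> b \<in> carrier A" using a b by simp
  show "elementary u m i j (a \<otimes>\<^bsub>A\<^esub> b) = elementary u m i j a \<otimes>\<^bsub>A\<^esub> elementary u m i j b"
  proof (rule carrier_A_eqI)
    fix k assume "k < length lam"
    then show "elementary u m i j (a \<otimes>\<^bsub>A\<^esub> b) k = (elementary u m i j a \<otimes>\<^bsub>A\<^esub> elementary u m i j b) k"
      using eq a b ab i j by (simp add: elementary_def) (simp add: mult_A)
  qed (use a b j in \<open>auto intro!: elementary_carrier\<close>)
qed (use j in \<open>rule elementary_carrier\<close>)

text \<open>The inverse is again elementary, with unit \<open>u'\<close> and multiplier
  \<open>- u' * m\<close>, chosen so that the contributions of coordinate \<open>i\<close> cancel
  modulo \<open>q ^ (lam ! j)\<close>.\<close>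

lemma elementary_auto:
  assumes j: "j < length lam" and i: "i < length lam"
    and u: "q ^ (lam ! j) dvd u * u' - 1" and ij: "i = j \<Longrightarrow> m = 0"
    and m: "q ^ (lam ! j) dvd m * q ^ (lam ! i)"
  shows "elementary u m i j \<in> auto A"
proof -
  have u': "q ^ (lam ! j) dvd u' * u - 1" using u by (simp add: mult.commute)
  have m': "q ^ (lam ! j) dvd u * (- u' * m) + m"
  proof -
    have "u * (- u' * m) + m = - (u * u' - 1) * m" by (simp add: algebra_simps)
    then show ?thesis using u by (metis dvd_minus_iff dvd_mult2)
  qed
  have "bij_betw (elementary u m i j) (carrier A) (carrier A)"
  proof (rule bij_betw_byWitness[where f' = "elementary u' (- u' * m) i j"])
    show "\<forall>a\<in>carrier A. elementary u' (- u' * m) i j (elementary u m i j a) = a"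
      using elementary_inverse[OF j _ _ u'] ij by simp
    show "\<forall>a\<in>carrier A. elementary u m i j (elementary u' (- u' * m) i j a) = a"
      using elementary_inverse[OF j _ _ u m'] ij by simp
  qed (use j elementary_carrier in auto)
  moreover have "elementary u m i j \<in> extensional (carrier A)"
    by (simp add: elementary_def)
  ultimately show ?thesis
    using elementary_hom[OF j i m] by (simp add: auto_def Bij_def)
qed

section \<open>Automorphisms acting on cosets\<close>

lemma auto_inverse:
  assumes "g \<in> auto A"
  obtains h where "h \<in> auto A" "\<And>a. a \<in> carrier A \<Longrightarrow> h (g a) = a" "\<And>a. a \<in> carrier A \<Longrightarrow> g (h a) = a"
proof
  \<comment> \<open>The restriction makes the inverse extensional, as membership in
    \<open>auto\<close> demands.\<close>
  let ?h = "restrict (inv_into (carrier A) g) (carrier A)"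
  have g: "g \<in> hom A A" "g \<in> Bij (carrier A)" using assms by (auto simp: auto_def)
  then have bij: "bij_betw g (carrier A) (carrier A)" by (simp add: Bij_def)
  show "?h \<in> auto A"
    unfolding auto_def using restrict_inv_into_hom[OF g] restrict_inv_into_Bij[OF g(2)] by blast
  show "?h (g a) = a" "g (?h a) = a" if "a \<in> carrier A" for a
    using bij that bij_betw_inv_into_left[OF bij] bij_betw_inv_into_right[OF bij]
      bij_betwE[OF bij] by auto
qed

lemma auto_compose:
  assumes "g \<in> auto A" "h \<in> auto A" shows "compose (carrier A) g h \<in> auto A"
  using assms hom_compose by (auto simp: auto_def compose_Bij)

lemma auto_carrier: "g \<in> auto A \<Longrightarrow> a \<in> carrier A \<Longrightarrow> g a \<in> carrier A"
  by (auto simp: auto_def hom_def)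

text \<open>Both \<open>g\<close> and its inverse are endomorphisms, and each of them preserves
  \<open>A_ideal\<close>.\<close>

lemma auto_A_ideal:
  assumes K: "ideal K" and g: "g \<in> auto A" and a: "a \<in> carrier A"
  shows "g a \<in> A_ideal p lam K \<longleftrightarrow> a \<in> A_ideal p lam K"
proof -
  obtain h where h: "h \<in> auto A" "h (g a) = a" using auto_inverse[OF g] a by metis
  have "h \<in> hom A A" "g \<in> hom A A" using g h by (auto simp: auto_def)
  then show ?thesis using hom_A_ideal[OF K] h(2) by metis
qed

lemma auto_image_A_ideal:
  assumes K: "ideal K" and g: "g \<in> auto A"
  shows "g ` A_ideal p lam K = A_ideal p lam K"
proof
  show "g ` A_ideal p lam K \<subseteq> A_ideal p lam K"
    using auto_A_ideal[OF K g] A_ideal_carrier by blast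
  obtain h where h: "h \<in> auto A" "\<And>a. a \<in> carrier A \<Longrightarrow> g (h a) = a" using auto_inverse[OF g] by metis
  show "A_ideal p lam K \<subseteq> g ` A_ideal p lam K"
  proof
    fix a assume a: "a \<in> A_ideal p lam K"
    then have "h a \<in> A_ideal p lam K" using auto_A_ideal[OF K h(1)] A_ideal_carrier by blast
    then show "a \<in> g ` A_ideal p lam K" using h(2) A_ideal_carrier[OF a] by (metis imageI)
  qed
qed

text \<open>The action on the subquotient is by setwise images; since \<open>g\<close> maps
  \<open>A_ideal p lam K\<close> onto itself, it can be computed on representatives.\<close>

lemma auto_image_coset:
  assumes K: "ideal K" and g: "g \<in> auto A" and a: "a \<in> carrier A"
  shows "g ` (A_ideal p lam K #>\<^bsub>A\<^esub> a) = A_ideal p lam K #>\<^bsub>A\<^esub> g a"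
proof -
  have hom: "g \<in> hom A A" using g by (auto simp: auto_def)
  have mult: "g (h \<otimes>\<^bsub>A\<^esub> a) = g h \<otimes>\<^bsub>A\<^esub> g a" if "h \<in> A_ideal p lam K" for h
    by (rule hom_mult[OF hom A_ideal_carrier[OF that] a])
  have "g ` (A_ideal p lam K #>\<^bsub>A\<^esub> a) = (\<Union>h\<in>A_ideal p lam K. {g (h \<otimes>\<^bsub>A\<^esub> a)})"
    by (auto simp: r_coset_def)
  also have "\<dots> = (\<Union>h\<in>A_ideal p lam K. {g h \<otimes>\<^bsub>A\<^esub> g a})"
    by (rule SUP_cong[OF refl]) (simp only: mult)
  also have "\<dots> = (g ` A_ideal p lam K) #>\<^bsub>A\<^esub> g a"
    by (simp add: r_coset_def)
  finally show ?thesis by (simp only: auto_image_A_ideal[OF K g])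
qed

lemma coset_eqI:
  assumes K: "ideal K" and a: "a \<in> carrier A" and b: "b \<in> carrier A"
    and ab: "\<And>i. i < length lam \<Longrightarrow> q ^ ex K i dvd b i - a i"
  shows "A_ideal p lam K #>\<^bsub>A\<^esub> a = A_ideal p lam K #>\<^bsub>A\<^esub> b"
proof (rule repr_independence)
  have "b \<otimes>\<^bsub>A\<^esub> inv\<^bsub>A\<^esub> a \<in> A_ideal p lam K"
  proof -
    have "q ^ ex K i dvd (b i + (- a i) mod q ^ (lam ! i)) mod q ^ (lam ! i)" if "i < length lam" for i
      using ab[OF that] by (simp add: mod_simps dvd_mod ideal_exp_le le_imp_power_dvd)
    then have "q ^ ex K i dvd (b \<otimes>\<^bsub>A\<^esub> inv\<^bsub>A\<^esub> a) i" if "i < length lam" for i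
      using that a by (simp add: mult_A inv_A)
    then show ?thesis using a b by (simp add: mem_A_ideal[OF K])
  qed
  then have "(b \<otimes>\<^bsub>A\<^esub> inv\<^bsub>A\<^esub> a) \<otimes>\<^bsub>A\<^esub> a \<in> A_ideal p lam K #>\<^bsub>A\<^esub> a"
    using A_ideal_carrier a by (intro rcosI) auto
  then show "b \<in> A_ideal p lam K #>\<^bsub>A\<^esub> a"
    using a b by (simp add: m_assoc)
qed (use a subgroup_A_ideal[OF K] in auto)

section \<open>Moving one coordinate by an automorphism\<close>

lemma unit_inverse_mod:
  fixes w :: int
  assumes "\<not> q dvd w"
  obtains u where "q ^ k dvd u * w - 1"
proof -
  have "coprime q w" using prime_imp_coprime[OF prime_q assms] .
  then have "gcd w (q ^ k) = 1" by (simp add: coprime_commute)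
  then obtain u v where "u * w + v * q ^ k = 1" using bezout_int[of w "q ^ k"] by auto
  then have "u * w - 1 = (- v) * q ^ k" by (simp add: algebra_simps)
  then show thesis using that by (metis dvd_triv_right)
qed

text \<open>If i = j, the multiplicities of a j and p^t agree and a unit multiple suffices; otherwise
  a suitable multiple of a i is added to a j.\<close>

lemma auto_set_coord:
  assumes a: "a \<in> carrier A" and j: "j < length lam" and i: "i < length lam" and ai: "a i \<noteq> 0"
    and t: "t < lam ! j" "q ^ t dvd a j" "fle (t, lam ! j) (multiplicity q (a i), lam ! i)"
  obtains g where "g \<in> auto A" "g a = a(j := q ^ t)"
proof -
  let ?v = "multiplicity q (a i)" and ?Q = "q ^ (lam ! j)"
  have vt: "?v \<le> t" and vl: "lam ! j - t \<le> lam ! i - ?v" using t(3) by (auto simp: fle_def)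
  have qu: "\<not> is_unit q" using prime_q by (auto dest: not_prime_unit)
  obtain w where w: "a i = q ^ ?v * w" "\<not> q dvd w"
    using multiplicity_decompose'[OF ai qu] by metis
  obtain u where u: "?Q dvd u * w - 1" using unit_inverse_mod[OF w(2)] .
  have small: "q ^ t mod ?Q = q ^ t"
    using t(1) q_gt_1 by (intro mod_pos_pos_trivial) (auto intro: power_strict_increasing)
  show thesis
  proof (cases "i = j")
    case True
    have "t \<le> ?v" using t(2) ai qu True by (simp add: power_dvd_iff_le_multiplicity)
    then have "a j = q ^ t * w" using w True vt by simp
    then have "u * a j - q ^ t = (u * w - 1) * q ^ t" by (simp add: algebra_simps)
    then have "(u * a j) mod ?Q = q ^ t" using u small by (metis dvd_mult2 mod_eq_dvd_iff)
    then have "elementary u 0 j j a = a(j := q ^ t)" using a by (simp add: elementary_def)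
    moreover have "elementary u 0 j j \<in> auto A" using elementary_auto[OF j j u] by simp
    ultimately show thesis using that by blast
  next
    case False
    obtain z where z: "a j = q ^ t * z" using t(2) by (rule dvdE)
    \<comment> \<open>Here \<open>m * a i\<close> is congruent to \<open>q ^ t * (1 - z)\<close>,
      the amount missing from \<open>a j\<close>: \<open>u\<close> inverts the unit part of
      \<open>a i\<close>, and \<open>q ^ (t - ?v)\<close> raises its \<open>q\<close>-part to
      \<open>q ^ t\<close>.\<close>
    define m where "m = q ^ (t - ?v) * u * (1 - z)"
    have tv: "q ^ (t - ?v) * q ^ ?v = q ^ t" using vt by (simp flip: power_add)
    have "a j + m * a i - q ^ t = (u * w - 1) * (q ^ (t - ?v) * q ^ ?v) * (1 - z)
        + q ^ (t - ?v) * q ^ ?v * (1 - z) + a j - q ^ t"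
      by (subst w(1)) (simp add: m_def algebra_simps)
    also have "\<dots> = (u * w - 1) * (q ^ t * (1 - z))"
      unfolding tv z by (simp add: algebra_simps)
    finally have "(a j + m * a i) mod ?Q = q ^ t"
      using u small by (metis dvd_mult2 mod_eq_dvd_iff)
    then have "elementary 1 m i j a = a(j := q ^ t)" using a by (simp add: elementary_def)
    moreover have "elementary 1 m i j \<in> auto A"
    proof (rule elementary_auto[OF j i, of 1 1])
      \<comment> \<open>The second inequality of \<open>fle\<close> is what makes \<open>m\<close>
        define a homomorphism from coordinate \<open>i\<close> to coordinate \<open>j\<close>;
        \<open>?v < lam ! i\<close> keeps its subtraction from truncating.\<close>
      have "?v < lam ! i"
        using coord_orbits_subset[OF a] i ai by (auto simp: coord_orbits_def fundP_of_def fundP_def)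
      then have "lam ! j \<le> t - ?v + lam ! i" using vl vt t(1) by simp
      then have "?Q dvd q ^ (t - ?v + lam ! i)" by (rule le_imp_power_dvd)
      then show "?Q dvd m * q ^ (lam ! i)"
        by (simp add: m_def power_add mult_ac dvd_mult dvd_mult2)
    qed (use False in auto)
    ultimately show thesis using that by blast
  qed
qed

section \<open>Canonical elements\<close>

text \<open>The reduction matters only for \<open>ex K i = lam ! i\<close>, where it yields the
  coordinate zero.\<close>

definition canonical :: "(nat \<times> nat) set \<Rightarrow> nat \<Rightarrow> int" where
  "canonical K = (\<lambda>i\<in>{..<length lam}. q ^ ex K i mod q ^ (lam ! i))"

lemma canonical_carrier: "canonical K \<in> carrier A"
  by (auto simp: canonical_def carrier_A)

lemma canonical_A_ideal: "ideal K \<Longrightarrow> canonical K \<in> A_ideal p lam K"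
  using canonical_carrier
  by (simp add: mem_A_ideal canonical_def dvd_mod ideal_exp_le le_imp_power_dvd)

text \<open>The nonzero coordinates contribute the largest element of \<open>K\<close> in each
  column that \<open>K\<close> meets, and these generate \<open>K\<close>.\<close>

lemma lam_ideal_of_canonical:
  assumes K: "ideal K" shows "lam_ideal_of p lam (canonical K) = K"
proof
  show "lam_ideal_of p lam (canonical K) \<subseteq> K"
    using canonical_A_ideal[OF K] by (simp add: A_ideal_def)
  show "K \<subseteq> lam_ideal_of p lam (canonical K)"
  proof
    fix x assume x: "x \<in> K"
    then have xP: "x \<in> fundP_of lam" using K by (auto simp: is_ideal_def)
    then obtain r i where r: "x = (r, lam ! i)" "i < length lam" "r < lam ! i"
      by (rule fundP_of_E)
    then have le: "ex K i \<le> r" using mem_ideal_iff[OF K] x by blast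
    then have "q ^ ex K i mod q ^ (lam ! i) = q ^ ex K i"
      using r q_gt_1 by (intro mod_pos_pos_trivial) (auto intro: power_strict_increasing)
    then have c: "canonical K i = q ^ ex K i" using r by (simp add: canonical_def)
    have "multiplicity q (q ^ ex K i) = ex K i" using prime_q by simp
    then have "(ex K i, lam ! i) \<in> coord_orbits p lam (canonical K)"
      using r c by (auto simp: coord_orbits_def intro!: exI[of _ i])
    moreover have "fle x (ex K i, lam ! i)" using le r by (simp add: fle_def)
    ultimately show "x \<in> lam_ideal_of p lam (canonical K)"
      using xP by (auto simp: lam_ideal_of_eq[OF canonical_carrier])
  qed
qed

section \<open>The ideal as a complete invariant of the orbit\<close>

text \<open>For an ideal \<open>K\<close> containing \<open>J\<close>, membership in
  \<open>A_ideal p lam K\<close> is unchanged by automorphisms and by adding elements of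
  \<open>A_ideal p lam J\<close>. Taking for \<open>K\<close> each of the two sides gives the two
  inclusions.\<close>

lemma lam_ideal_of_Un_eq_if_coset_eq:
  assumes J: "ideal J" and a: "a \<in> carrier A" and b: "b \<in> carrier A" and g: "g \<in> auto A"
    and eq: "A_ideal p lam J #>\<^bsub>A\<^esub> g a = A_ideal p lam J #>\<^bsub>A\<^esub> b"
  shows "lam_ideal_of p lam b \<union> J = lam_ideal_of p lam a \<union> J"
proof -
  have K: "lam_ideal_of p lam b \<subseteq> K \<longleftrightarrow> lam_ideal_of p lam a \<subseteq> K" if K: "ideal K" and JK: "J \<subseteq> K" for K
  proof -
    interpret K: subgroup "A_ideal p lam K" A by (rule subgroup_A_ideal[OF K])
    have sub: "A_ideal p lam J \<subseteq> A_ideal p lam K" by (rule A_ideal_mono[OF JK])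
    have ga: "g a \<in> carrier A" using auto_carrier[OF g a] .
    have b_in: "b \<in> A_ideal p lam J #>\<^bsub>A\<^esub> g a" and ga_in: "g a \<in> A_ideal p lam J #>\<^bsub>A\<^esub> b"
      using rcos_self[OF b subgroup_A_ideal[OF J]] rcos_self[OF ga subgroup_A_ideal[OF J]] eq by auto
    have "y \<in> A_ideal p lam K" if "y \<in> A_ideal p lam J #>\<^bsub>A\<^esub> x" "x \<in> A_ideal p lam K" for x y
      using that sub by (auto simp: r_coset_def)
    from this[OF b_in] this[OF ga_in] have "b \<in> A_ideal p lam K \<longleftrightarrow> g a \<in> A_ideal p lam K" by iprover
    also have "\<dots> \<longleftrightarrow> a \<in> A_ideal p lam K" by (rule auto_A_ideal[OF K g a])
    finally show ?thesis by (simp only: A_ideal_iff[OF a] A_ideal_iff[OF b])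
  qed
  show ?thesis
    using K[of "lam_ideal_of p lam b \<union> J"] K[of "lam_ideal_of p lam a \<union> J"] J
      ideal_lam_ideal_of[OF a] ideal_lam_ideal_of[OF b] is_ideal_Un by blast
qed

lemma coset_set_coord:
  assumes J: "ideal J" and a: "a \<in> carrier A" and j: "j < length lam"
    and K: "K = lam_ideal_of p lam a \<union> J"
  obtains g where "g \<in> auto A"
    "A_ideal p lam J #>\<^bsub>A\<^esub> g a = A_ideal p lam J #>\<^bsub>A\<^esub> a(j := canonical K j)"
proof -
  have idK: "ideal K" unfolding K by (intro is_ideal_Un ideal_lam_ideal_of a J)
  let ?t = "ex K j"
  have "a \<in> A_ideal p lam K" using a by (auto simp: A_ideal_def K)
  then have dvd: "q ^ ?t dvd a j" using j by (simp add: mem_A_ideal[OF idK])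
  have le: "?t \<le> ex J j" by (rule ideal_exp_antimono) (simp add: K)
  show thesis
  proof (cases "?t = ex J j")
    \<comment> \<open>Both values of coordinate \<open>j\<close> are divisible by
      \<open>q ^ ex J j\<close>, so the identity suffices. This includes
      \<open>?t = lam ! j\<close>, where \<open>K\<close> has no element to work with.\<close>
    case True
    let ?b = "a(j := canonical K j)"
    have b: "?b \<in> carrier A"
      using a canonical_carrier[of K] j by (auto simp: carrier_A extensional_def)
    have "q ^ ?t dvd canonical K j"
      using canonical_A_ideal[OF idK] j by (simp add: mem_A_ideal[OF idK])
    then have "A_ideal p lam J #>\<^bsub>A\<^esub> a = A_ideal p lam J #>\<^bsub>A\<^esub> ?b"
      using dvd True by (intro coset_eqI[OF J a b]) auto
    then show thesis using that[OF id_in_auto] a by simp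
  next
    case False
    then have lt: "?t < ex J j" using le by simp
    then have tj: "?t < lam ! j" using ideal_exp_le[of lam J j] by simp
    \<comment> \<open>An element of \<open>K\<close> outside \<open>J\<close> must come from
      \<open>a\<close>, so it lies below the orbit of some coordinate \<open>a i\<close>.\<close>
    then have "(?t, lam ! j) \<in> K" "(?t, lam ! j) \<notin> J"
      using lt mem_ideal_iff[OF idK j] mem_ideal_iff[OF J j] by auto
    then have "(?t, lam ! j) \<in> lam_ideal_of p lam a" by (simp add: K)
    then obtain i where i: "i < length lam" "a i \<noteq> 0" 
        "fle (?t, lam ! j) (multiplicity q (a i), lam ! i)"
      by (auto simp: lam_ideal_of_eq[OF a] coord_orbits_def)
    obtain g where g: "g \<in> auto A" "g a = a(j := q ^ ?t)"
      using auto_set_coord[OF a j i(1,2) tj dvd i(3)] .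
    have "q ^ ?t mod q ^ (lam ! j) = q ^ ?t"
      using tj q_gt_1 by (intro mod_pos_pos_trivial) (auto intro: power_strict_increasing)
    then show thesis using that[OF g(1)] g(2) j by (simp add: canonical_def)
  qed
qed

lemma coset_canonical:
  assumes J: "ideal J" and a: "a \<in> carrier A" and K: "K = lam_ideal_of p lam a \<union> J"
  obtains g where "g \<in> auto A" "A_ideal p lam J #>\<^bsub>A\<^esub> g a = A_ideal p lam J #>\<^bsub>A\<^esub> canonical K"
proof -
  define b where "b n = (\<lambda>i\<in>{..<length lam}. if i < n then canonical K i else a i)" for n
  have b: "b n \<in> carrier A" for n
    using a canonical_carrier[of K] by (auto simp: b_def carrier_A)
  have "\<exists>g\<in>auto A. A_ideal p lam J #>\<^bsub>A\<^esub> g a = A_ideal p lam J #>\<^bsub>A\<^esub> b n" if "n \<le> length lam" for n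
    using that
  proof (induction n)
    case 0
    have "b 0 = a" by (rule carrier_A_eqI[OF b a]) (simp add: b_def)
    then show ?case using a by (intro bexI[OF _ id_in_auto]) simp
  next
    case (Suc n)
    then obtain g where g: "g \<in> auto A" "A_ideal p lam J #>\<^bsub>A\<^esub> g a = A_ideal p lam J #>\<^bsub>A\<^esub> b n" by auto
    \<comment> \<open>The intermediate element has the same ideal, so the target
      \<open>canonical K\<close> stays fixed throughout the induction.\<close>
    have Kn: "K = lam_ideal_of p lam (b n) \<union> J"
      using lam_ideal_of_Un_eq_if_coset_eq[OF J a b g] K by simp
    have n: "n < length lam" using Suc.prems by simp
    obtain h where h: "h \<in> auto A"
        "A_ideal p lam J #>\<^bsub>A\<^esub> h (b n) = A_ideal p lam J #>\<^bsub>A\<^esub> (b n)(n := canonical K n)"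
      using coset_set_coord[OF J b n Kn] .
    have "(b n)(n := canonical K n) = b (Suc n)"
      using n by (auto simp: b_def fun_eq_iff)
    moreover have "A_ideal p lam J #>\<^bsub>A\<^esub> h (g a) = A_ideal p lam J #>\<^bsub>A\<^esub> h (b n)"
      using auto_image_coset[OF J h(1)] g(2) auto_carrier[OF g(1) a] b by metis
    ultimately have "A_ideal p lam J #>\<^bsub>A\<^esub> compose (carrier A) h g a = A_ideal p lam J #>\<^bsub>A\<^esub> b (Suc n)"
      using h(2) a by (simp add: compose_eq)
    then show ?case using auto_compose[OF h(1) g(1)] by blast
  qed
  moreover have "b (length lam) = canonical K"
    by (rule carrier_A_eqI[OF b canonical_carrier]) (simp add: b_def)
  ultimately show thesis using that by (metis order_refl)
qed

section \<open>Orbits in the subquotient and the bijection\<close>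

lemma carrier_subquotient:
  "carrier (subquotient p lam I J) = (\<lambda>a. A_ideal p lam J #>\<^bsub>A\<^esub> a) ` A_ideal p lam I"
  by (simp add: subquotient_def carrier_FactGroup r_coset_def)

lemma orbit_coset:
  assumes J: "ideal J" and a: "a \<in> A_ideal p lam I"
  shows "orbit (AutoGroup A) (subquotient_action p lam I J) (A_ideal p lam J #>\<^bsub>A\<^esub> a)
    = (\<lambda>g. A_ideal p lam J #>\<^bsub>A\<^esub> g a) ` auto A"
  using auto_image_coset[OF J _ A_ideal_carrier[OF a]] a
  by (auto simp: orbit_def AutoGroup_def subquotient_action_def carrier_subquotient)

text \<open>The elements \<open>h b\<close> and \<open>h (g a)\<close> define the same coset, and
  \<open>h\<close> after \<open>g\<close> is again an automorphism.\<close>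

lemma orbit_coset_subset:
  assumes J: "ideal J" and a: "a \<in> carrier A" and b: "b \<in> carrier A" and g: "g \<in> auto A"
    and eq: "A_ideal p lam J #>\<^bsub>A\<^esub> g a = A_ideal p lam J #>\<^bsub>A\<^esub> b"
  shows "(\<lambda>h. A_ideal p lam J #>\<^bsub>A\<^esub> h b) ` auto A \<subseteq> (\<lambda>h. A_ideal p lam J #>\<^bsub>A\<^esub> h a) ` auto A"
proof
  fix X assume "X \<in> (\<lambda>h. A_ideal p lam J #>\<^bsub>A\<^esub> h b) ` auto A"
  then obtain h where h: "h \<in> auto A" "X = A_ideal p lam J #>\<^bsub>A\<^esub> h b" by blast
  then have "X = A_ideal p lam J #>\<^bsub>A\<^esub> h (g a)"
    using eq auto_image_coset[OF J h(1)] auto_carrier[OF g a] b by metis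
  then have "X = A_ideal p lam J #>\<^bsub>A\<^esub> compose (carrier A) h g a" using a by (simp add: compose_eq)
  then show "X \<in> (\<lambda>h. A_ideal p lam J #>\<^bsub>A\<^esub> h a) ` auto A" using auto_compose[OF h(1) g] by blast
qed

lemma orbit_coset_eq:
  assumes J: "ideal J" and a: "a \<in> carrier A" and b: "b \<in> carrier A" and g: "g \<in> auto A"
    and eq: "A_ideal p lam J #>\<^bsub>A\<^esub> g a = A_ideal p lam J #>\<^bsub>A\<^esub> b"
  shows "(\<lambda>h. A_ideal p lam J #>\<^bsub>A\<^esub> h a) ` auto A = (\<lambda>h. A_ideal p lam J #>\<^bsub>A\<^esub> h b) ` auto A"
proof (rule antisym)
  \<comment> \<open>The inverse of \<open>g\<close> exchanges the roles of \<open>a\<close> and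
    \<open>b\<close>.\<close>
  obtain k where k: "k \<in> auto A" "k (g a) = a" using auto_inverse[OF g] a by metis
  have "A_ideal p lam J #>\<^bsub>A\<^esub> k b = A_ideal p lam J #>\<^bsub>A\<^esub> a"
    using eq k auto_image_coset[OF J k(1)] auto_carrier[OF g a] b by metis
  then show "(\<lambda>h. A_ideal p lam J #>\<^bsub>A\<^esub> h a) ` auto A \<subseteq> (\<lambda>h. A_ideal p lam J #>\<^bsub>A\<^esub> h b) ` auto A"
    by (rule orbit_coset_subset[OF J b a k(1)])
qed (rule orbit_coset_subset[OF J a b g eq])

text \<open>The second conjunct makes the correspondence canonical: every orbit is of the form
  \<open>orb a\<close>, so it determines \<open>f\<close> on all orbits.\<close>

lemma subquotient_orbits_bij:
  assumes I: "ideal I" and J: "ideal J" and JI: "J \<subseteq> I"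
  defines "orb \<equiv> \<lambda>a. orbit (AutoGroup A) (subquotient_action p lam I J) (A_ideal p lam J #>\<^bsub>A\<^esub> a)"
  shows "\<exists>f. bij_betw f
      (orbits (AutoGroup A) (carrier (subquotient p lam I J)) (subquotient_action p lam I J))
      (ideals_between lam J I)
    \<and> (\<forall>a\<in>A_ideal p lam I. f (orb a) = lam_ideal_of p lam a \<union> J)"
proof -
  \<comment> \<open>The union over all elements of all cosets in the orbit avoids choosing a
    representative; together with \<open>J\<close>, each element contributes the same ideal.\<close>
  define f where "f = (\<lambda>Y. (\<Union>X\<in>Y. \<Union>b\<in>X. lam_ideal_of p lam b) \<union> J)"
  let ?c = "\<lambda>a. A_ideal p lam J #>\<^bsub>A\<^esub> a"
  have orb: "orb a = (\<lambda>g. ?c (g a)) ` auto A" if "a \<in> A_ideal p lam I" for a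
    unfolding orb_def by (rule orbit_coset[OF J that])
  have f: "f (orb a) = lam_ideal_of p lam a \<union> J" if aI: "a \<in> A_ideal p lam I" for a
  proof -
    have a: "a \<in> carrier A" using aI by (rule A_ideal_carrier)
    have "lam_ideal_of p lam b \<union> J = lam_ideal_of p lam a \<union> J"
      if g: "g \<in> auto A" and b: "b \<in> ?c (g a)" for g b
    proof (rule lam_ideal_of_Un_eq_if_coset_eq[OF J a _ g])
      have ga: "g a \<in> carrier A" using auto_carrier[OF g a] .
      show "b \<in> carrier A" using b ga A_ideal_carrier by (auto simp: r_coset_def)
      show "?c (g a) = ?c b" by (rule repr_independence[OF b ga subgroup_A_ideal[OF J]])
    qed
    \<comment> \<open>The identity automorphism shows that \<open>a\<close> itself occurs in the
      union.\<close>
    moreover have "(\<lambda>x\<in>carrier A. x) \<in> auto A" "a \<in> ?c ((\<lambda>x\<in>carrier A. x) a)"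
      using id_in_auto rcos_self[OF a subgroup_A_ideal[OF J]] a by auto
    ultimately show ?thesis unfolding f_def orb[OF aI] by blast
  qed
  have orbits: "orbits (AutoGroup A) (carrier (subquotient p lam I J)) (subquotient_action p lam I J)
      = orb ` A_ideal p lam I"
    by (auto simp: orbits_def carrier_subquotient orb_def)
  have "bij_betw f (orb ` A_ideal p lam I) (ideals_between lam J I)"
    unfolding bij_betw_def
  proof
    show "inj_on f (orb ` A_ideal p lam I)"
    proof (rule inj_onI, clarify)
      fix a b assume aI: "a \<in> A_ideal p lam I" and bI: "b \<in> A_ideal p lam I" and eq: "f (orb a) = f (orb b)"
      have a: "a \<in> carrier A" and b: "b \<in> carrier A" using aI bI A_ideal_carrier by auto
      define K where "K = lam_ideal_of p lam a \<union> J"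
      have Kb: "K = lam_ideal_of p lam b \<union> J" using eq f aI bI by (simp add: K_def)
      \<comment> \<open>Equal ideals give the same canonical element, whose orbit contains the
        classes of both \<open>a\<close> and \<open>b\<close>.\<close>
      obtain g h where g: "g \<in> auto A" "?c (g a) = ?c (canonical K)"
          and h: "h \<in> auto A" "?c (h b) = ?c (canonical K)"
        using coset_canonical[OF J a K_def] coset_canonical[OF J b Kb] by metis
      show "orb a = orb b"
        unfolding orb[OF aI] orb[OF bI]
        using orbit_coset_eq[OF J a canonical_carrier g] orbit_coset_eq[OF J b canonical_carrier h] by simp
    qed
    show "f ` orb ` A_ideal p lam I = ideals_between lam J I"
    proof
      show "f ` orb ` A_ideal p lam I \<subseteq> ideals_between lam J I"
        using f JI J is_ideal_Un ideal_lam_ideal_of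
        by (auto simp: ideals_between_def A_ideal_def)
      show "ideals_between lam J I \<subseteq> f ` orb ` A_ideal p lam I"
      proof
        fix K assume "K \<in> ideals_between lam J I"
        then have K: "ideal K" "J \<subseteq> K" "K \<subseteq> I" by (auto simp: ideals_between_def)
        \<comment> \<open>The canonical element of \<open>K\<close> is a preimage;
          \<open>J \<subseteq> K\<close> makes adding \<open>J\<close> harmless.\<close>
        have "canonical K \<in> A_ideal p lam I" using canonical_A_ideal[OF K(1)] A_ideal_mono[OF K(3)] by blast
        moreover from f[OF this] have "f (orb (canonical K)) = K"
          using lam_ideal_of_canonical[OF K(1)] K(2) by auto
        ultimately show "K \<in> f ` orb ` A_ideal p lam I" by (metis imageI)
      qed
    qed
  qed
  then show ?thesis using f orbits by auto
qed

end

theorem theorem9p1: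
  fixes p :: nat and lam :: "nat list" and I J :: "(nat \<times> nat) set"
  assumes "prime p"
    and "is_partition lam"
    and "is_ideal (fundP_of lam) I"
    and "is_ideal (fundP_of lam) J"
    and "J \<subseteq> I"
  shows "(\<exists>f. bij_betw f
              (orbits (AutoGroup (Apgrp p lam)) (carrier (subquotient p lam I J))
                 (subquotient_action p lam I J))
              (ideals_between lam J I)
            \<and> (\<forall>a\<in>A_ideal p lam I.
                 f (orbit (AutoGroup (Apgrp p lam)) (subquotient_action p lam I J)
                      (A_ideal p lam J #>\<^bsub>Apgrp p lam\<^esub> a))
                 = lam_ideal_of p lam a \<union> J))
         \<and> bij_betw (\<lambda>K. K - J) (ideals_between lam J I) {L. is_ideal (I - J) L}"
proof -
  interpret abelian_p_group p lam by unfold_locales fact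
  show ?thesis
    using subquotient_orbits_bij[OF assms(3-5)] ideals_between_bij_ideals_diff[OF assms(3-5)] by blast
qed

end
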